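(* Let $K$ be a field, let $f(x)=ax^2+bx+c\in K[x]$ with $a\neq 0$, and assume that the derivative $f'$ is non-zero. If $f$ has a newly reducible $n$th iterate over $K$ for some $n\geq 2$, then there is a monic irreducible $h\in K[x]$ of degree $2^{n-1}$ such that $$f^n(x)=a^{2^n-1}\,h(x)\,h\bigl(-(x+(b/a))\bigr).$$ In particular, if $K$ has characteristic not equal to $2$, then $f^n(x+\gamma)$ is symmetrically reducible over $K$, where $\gamma=-b/(2a)$ is the critical point of $f$.
   Context: $f^i$ denotes the $i$-th iterate of $f$ under composition. $f$ has a newly reducible $n$th iterate over $K$ if $f^{n-1}$ is irreducible over $K$ but $f^n$ is not irreducible over $K$. A polynomial $F\in K[x]$ of degree $2N$, $N\ge 1$, is symmetrically reducible over $K$ if there exist a monic $g\in K[x]$ and $C\in K$ with $F(x)=C\,g(x)g(-x)$. *)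

theory Defs
  imports "HOL-Computational_Algebra.Polynomial"
begin

definition iterate_poly :: "'a::comm_semiring_1 poly \<Rightarrow> nat \<Rightarrow> 'a poly" where
  "iterate_poly f n = (pcompose f ^^ n) [:0, 1:]"

definition newly_reducible_iterate :: "'a::field poly \<Rightarrow> nat \<Rightarrow> bool" where
  "newly_reducible_iterate f n \<longleftrightarrow>
     n \<ge> 1 \<and> irreducible (iterate_poly f (n - 1)) \<and> \<not> irreducible (iterate_poly f n)"

definition symmetrically_reducible :: "'a::field poly \<Rightarrow> bool" where
  "symmetrically_reducible F \<longleftrightarrow>
     (\<exists>N\<ge>1. degree F = 2 * N) \<and>
     (\<exists>g C. lead_coeff g = 1 \<and> F = smult C (g * pcompose g [:0, -1:]))"

end

theory Submission
  imports Defs "HOL-Computational_Algebra.Polynomial_Factorial"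
begin

text \<open>
  Write \<open>F = g \<circ> f\<close> with \<open>f = a x\<^sup>2 + b x + c\<close>, where \<open>F\<close> is the \<open>n\<close>-th and \<open>g\<close> the
  \<open>(n - 1)\<close>-st iterate of \<open>f\<close>.  The reflection \<open>s(x) = -(x + b/a)\<close> exchanges the two roots of
  every \<open>f - y\<close>, so \<open>f \<circ> s = f\<close> and hence \<open>F \<circ> s = F\<close>.  For a polynomial \<open>p\<close>, the product
  \<open>p \<cdot> (p \<circ> s)\<close> is the norm of \<open>p\<close> from \<open>K[x]\<close> down to its subring \<open>K[f]\<close>, of which
  \<open>K[x]\<close> is a free module with basis \<open>1, x\<close>; so it has the form \<open>P \<circ> f\<close>, with
  \<open>deg P = deg p\<close> (\<open>norm_in_quadratic_subring\<close>).

  Now suppose \<open>F = p q\<close> with \<open>p\<close>, \<open>q\<close> not units, and let \<open>P\<close>, \<open>Q\<close> be their norms.  The norm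
  of \<open>F\<close> is \<open>F\<^sup>2\<close>, so \<open>P Q = g\<^sup>2\<close> with \<open>P\<close>, \<open>Q\<close> not constant.  As \<open>g\<close> is prime, \<open>P\<close> must be a
  constant multiple of \<open>g\<close>, that is, \<open>p \<cdot> (p \<circ> s)\<close> is a constant multiple of \<open>F\<close>
  (\<open>norm_of_factor_of_irreducible_comp_quadratic\<close>).  This is the desired factorization, up to
  scaling.  It also shows that every nontrivial factor of \<open>F\<close> has degree \<open>deg g\<close>, so no such
  factor can split further: \<open>p\<close> is irreducible.

  This avoids passing to the field extension generated by a root of \<open>g\<close>, and treats all
  characteristics uniformly.  If \<open>2 \<noteq> 0\<close>, then \<open>s\<close> is the reflection about \<open>\<gamma> = -b/(2a)\<close>,
  and translation by \<open>\<gamma>\<close> turns it into \<open>x \<mapsto> -x\<close>.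
\<close>

lemma pcompose_idL: "pcompose [:0, 1:] q = q"
  for q :: "'a::comm_semiring_1 poly"
  by (simp add: pcompose_pCons)

lemma iterate_poly_Suc: "iterate_poly f (Suc n) = pcompose f (iterate_poly f n)"
  by (simp add: iterate_poly_def)

lemma iterate_poly_Suc_right: "iterate_poly f (Suc n) = pcompose (iterate_poly f n) f"
proof (induction n)
  case 0
  then show ?case by (simp add: iterate_poly_def pcompose_pCons)
next
  case (Suc n)
  then show ?case by (metis iterate_poly_Suc pcompose_assoc)
qed

lemma degree_iterate_poly:
  fixes f :: "'a::idom poly"
  shows "degree (iterate_poly f n) = degree f ^ n"
  by (induction n) (simp_all add: iterate_poly_def degree_pcompose)

lemma lead_coeff_iterate_quadratic:
  fixes a b c :: "'a::field"
  assumes "a \<noteq> 0"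
  shows "lead_coeff (iterate_poly [:c, b, a:] n) = a ^ (2 ^ n - 1)"
proof (induction n)
  case 0
  then show ?case by (simp add: iterate_poly_def)
next
  case (Suc n)
  have "degree (iterate_poly [:c, b, a:] n) > 0"
    using assms by (simp add: degree_iterate_poly)
  then have "lead_coeff (iterate_poly [:c, b, a:] (Suc n)) = a * (a ^ (2 ^ n - 1)) ^ 2"
    using assms Suc.IH by (simp add: iterate_poly_Suc lead_coeff_comp power2_eq_square)
  also have "\<dots> = a ^ Suc ((2 ^ n - 1) * 2)"
    by (simp add: power_mult)
  also have "Suc ((2 ^ n - 1) * 2) = (2::nat) ^ Suc n - 1"
    by (cases "(2::nat) ^ n") auto
  finally show ?case .
qed

text \<open>
  \<open>K[x]\<close> is generated by \<open>1\<close> and \<open>x\<close> as a module over \<open>K[f]\<close>: since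
  \<open>x\<^sup>2 = (f - c)/a - (b/a) x\<close>, the span of \<open>1\<close> and \<open>x\<close> is closed under multiplication by \<open>x\<close>.
\<close>

lemma quadratic_decomposition:
  fixes a b c :: "'a::field"
  assumes "a \<noteq> 0"
  shows "\<exists>u v. p = pcompose u [:c, b, a:] + [:0, 1:] * pcompose v [:c, b, a:]"
proof (induction p)
  case 0
  show ?case by (rule exI[of _ 0], rule exI[of _ 0]) simp
next
  case (pCons k p)
  then obtain u v where p: "p = pcompose u [:c, b, a:] + [:0, 1:] * pcompose v [:c, b, a:]"
    by blast
  have square: "[:0, 0, 1:] = smult (1 / a) ([:c, b, a:] - [:c:]) - smult (b / a) [:0, 1:]"
    using assms by simp
  have "pCons k p = [:k:] + [:0, 1:] * p"
    by simp
  also have "\<dots> = [:k:] + [:0, 1:] * pcompose u [:c, b, a:] + [:0, 0, 1:] * pcompose v [:c, b, a:]"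
    unfolding p by (simp add: distrib_left)
  also have "\<dots> = pcompose ([:k:] + [:- c / a, 1 / a:] * v) [:c, b, a:]
        + [:0, 1:] * pcompose (u - smult (b / a) v) [:c, b, a:]"
    unfolding square
    by (simp add: pcompose_add pcompose_diff pcompose_mult pcompose_smult pcompose_pCons
        algebra_simps smult_add_right smult_diff_right)
  finally show ?case by blast
qed

text \<open>
  \<open>x\<close> and \<open>s = -(x + b/a)\<close> have sum \<open>-b/a\<close> and product \<open>(c - f)/a\<close>, both in \<open>K[f]\<close>.
  Hence \<open>K[f]\<close> contains the product of \<open>p = u(f) + x v(f)\<close> and its conjugate
  \<open>p \<circ> s\<close>, which equals \<open>u(f) + s v(f)\<close> because \<open>f \<circ> s = f\<close>.
\<close>

lemma norm_in_quadratic_subring: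
  fixes a b c :: "'a::field"
  assumes "a \<noteq> 0"
  shows "\<exists>P. p * pcompose p [:-(b / a), -1:] = pcompose P [:c, b, a:]"
proof -
  define f where "f = [:c, b, a:]"
  define s where "s = [:-(b / a), -1:]"
  have fs: "pcompose f s = f"
    using assms by (simp add: f_def s_def pcompose_pCons algebra_simps)
  obtain u v where p: "p = pcompose u f + [:0, 1:] * pcompose v f"
    using quadratic_decomposition[OF assms] unfolding f_def by blast
  have ps: "pcompose p s = pcompose u f + s * pcompose v f"
    unfolding p pcompose_add pcompose_mult pcompose_assoc[symmetric] fs pcompose_idL ..
  have trace: "[:0, 1:] + s = [:-(b / a):]"
    and norm: "[:0, 1:] * s = pcompose [:c / a, -1 / a:] f"
    using assms by (simp_all add: s_def f_def pcompose_pCons)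
  have "p * pcompose p s = (pcompose u f)\<^sup>2
      + ([:0, 1:] + s) * (pcompose u f * pcompose v f) + ([:0, 1:] * s) * (pcompose v f)\<^sup>2"
    unfolding ps unfolding p by algebra
  also have "\<dots> = pcompose (u\<^sup>2 + [:-(b / a):] * (u * v) + [:c / a, -1 / a:] * v\<^sup>2) f"
    unfolding trace norm
    by (simp only: pcompose_add pcompose_mult power2_eq_square pcompose_const)
  finally show ?thesis
    unfolding f_def s_def by blast
qed

text \<open>
  The norms of \<open>p\<close> and \<open>q\<close> multiply to the square of the prime \<open>g\<close>, and neither is constant,
  so each is an associate of \<open>g\<close>.  The degree of \<open>p\<close>, being that of its norm, is forced as well;
  this makes nontrivial factors irreducible.
\<close>

lemma norm_of_factor_of_irreducible_comp_quadratic: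
  fixes a b c :: "'a::field" and g p q :: "'a poly"
  assumes a: "a \<noteq> 0" and g: "irreducible g"
    and pq: "pcompose g [:c, b, a:] = p * q"
    and p: "\<not> is_unit p" and q: "\<not> is_unit q"
  obtains k where "k \<noteq> 0"
    "p * pcompose p [:-(b / a), -1:] = smult k (pcompose g [:c, b, a:])"
    "degree p = degree g"
proof -
  define f where "f = [:c, b, a:]"
  define s where "s = [:-(b / a), -1:]"
  have f2: "degree f = 2" and s1: "degree s = 1" using a by (simp_all add: f_def s_def)
  have fs: "pcompose f s = f"
    using a by (simp add: f_def s_def pcompose_pCons algebra_simps)
  obtain P where P: "p * pcompose p s = pcompose P f"
    using norm_in_quadratic_subring[OF a] unfolding f_def s_def by blast
  obtain Q where Q: "q * pcompose q s = pcompose Q f"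
    using norm_in_quadratic_subring[OF a] unfolding f_def s_def by blast
  have g0: "g \<noteq> 0" using g by auto
  have "pcompose g f \<noteq> 0"
    using g0 f2 by (simp add: pcompose_eq_0_iff)
  then have p0: "p \<noteq> 0" and q0: "q \<noteq> 0"
    using pq unfolding f_def by auto
  have deg_norm: "degree R = degree r"
    if "r * pcompose r s = pcompose R f" "r \<noteq> 0" for r R
  proof -
    have "pcompose r s \<noteq> 0" using that s1 by (simp add: pcompose_eq_0_iff)
    then have "degree (r * pcompose r s) = 2 * degree r"
      using that(2) s1 by (simp add: degree_mult_eq degree_pcompose)
    then have "2 * degree R = 2 * degree r"
      using that(1) f2 by (simp add: degree_pcompose)
    then show ?thesis by simp
  qed
  have degP: "degree P = degree p" and degQ: "degree Q = degree q"
    using deg_norm P Q p0 q0 by blast+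
  have nonunit: "\<not> is_unit P" "\<not> is_unit Q"
  proof -
    have "degree P \<noteq> 0" "degree Q \<noteq> 0"
      using p q p0 q0 degP degQ by (simp_all add: is_unit_iff_degree)
    then show "\<not> is_unit P" "\<not> is_unit Q"
      by (auto simp: is_unit_poly_iff)
  qed
  (* Both sides are the norm of g(f), computed from the invariance of g(f) under s on the left
     and from its factorization on the right. *)
  have "pcompose (g * g) f = pcompose g f * pcompose (pcompose g f) s"
    by (simp add: pcompose_mult fs flip: pcompose_assoc)
  also have "\<dots> = pcompose (P * Q) f"
    using pq unfolding f_def[symmetric] by (simp add: pcompose_mult mult_ac flip: P Q)
  finally have "pcompose (g * g - P * Q) f = 0"
    by (simp add: pcompose_diff)
  then have gg: "g * g = P * Q"
    using f2 by (simp add: pcompose_eq_0_iff)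
  have "g dvd P \<or> g dvd Q"
    using field_poly_irreducible_imp_prime[OF g] gg by (metis dvd_triv_left prime_elem_dvd_mult_iff)
  then obtain k where k: "P = smult k g"
  proof
    assume "g dvd P"
    then obtain t where t: "P = g * t" by blast
    with gg g0 have "g = t * Q" by simp
    then have "is_unit t" using g nonunit irreducibleD by blast
    then obtain d where "t = [:d:]" by (auto simp: is_unit_poly_iff)
    then show ?thesis using t that[of d] by simp
  next
    assume "g dvd Q"
    then obtain t where t: "Q = g * t" by blast
    with gg g0 have "g = P * t" by simp
    moreover from this have "is_unit t" using g nonunit irreducibleD by blast
    then obtain d where "t = [:d:]" "d \<noteq> 0"
      by (auto simp: is_unit_poly_iff dvd_field_iff)
    ultimately show ?thesis using that[of "1 / d"] by simp
  qed
  have "k \<noteq> 0" using k nonunit(1) P p0 s1 by (auto simp: pcompose_eq_0_iff)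
  show thesis
    by (rule that[OF \<open>k \<noteq> 0\<close>])
      (use P degP k \<open>k \<noteq> 0\<close> in \<open>simp_all add: pcompose_smult f_def s_def\<close>)
qed

theorem theorem2p5:
  fixes a b c :: "'a::field" and f :: "'a poly" and n :: nat
  assumes f: "f = [:c, b, a:]"
    and a: "a \<noteq> 0"
    and deriv: "pderiv f \<noteq> 0"
    and n: "n \<ge> 2"
    and newly: "newly_reducible_iterate f n"
  shows "(\<exists>h. lead_coeff h = 1 \<and> irreducible h \<and> degree h = 2 ^ (n - 1) \<and>
            iterate_poly f n = smult (a ^ (2 ^ n - 1)) (h * pcompose h [:-(b / a), -1:]))
       \<and> (CHAR('a) \<noteq> 2 \<longrightarrow>
            symmetrically_reducible (pcompose (iterate_poly f n) [:-(b / (2 * a)), 1:]))"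
proof -
  define g where "g = iterate_poly f (n - 1)"
  define F where "F = iterate_poly f n"
  define s where "s = [:-(b / a), -1:]"
  have Fg: "F = pcompose g [:c, b, a:]"
    using iterate_poly_Suc_right[of f "n - 1"] n f by (simp add: F_def g_def)
  have g: "irreducible g" and F: "\<not> irreducible F"
    using newly by (simp_all add: newly_reducible_iterate_def g_def F_def)
  have degg: "degree g = 2 ^ (n - 1)" and degF: "degree F = 2 ^ n"
    using a f by (simp_all add: g_def F_def degree_iterate_poly numeral_2_eq_2)
  have lcF: "lead_coeff F = a ^ (2 ^ n - 1)"
    using lead_coeff_iterate_quadratic[OF a] f by (simp add: F_def)
  have degF2: "degree F = 2 * degree g"
    using degg degF n by (cases n) auto
  have F0: "F \<noteq> 0"
    using degF by auto
  then have Fu: "\<not> is_unit F"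
    using degF by (simp add: is_unit_iff_degree)
  obtain p q where pq: "F = p * q" and pu: "\<not> is_unit p" and qu: "\<not> is_unit q"
    using F F0 Fu by (auto simp: irreducible_def)
  obtain k where norm_p: "p * pcompose p s = smult k F" and degp: "degree p = degree g"
    using norm_of_factor_of_irreducible_comp_quadratic[OF a g _ pu qu] pq Fg
    unfolding s_def by metis
  have p0: "p \<noteq> 0" using pq F0 by auto
  define h where "h = smult (1 / lead_coeff p) p"
  have lch: "lead_coeff h = 1" and degh: "degree h = 2 ^ (n - 1)"
  proof -
    have "lead_coeff p \<noteq> 0" using p0 by simp
    then show "lead_coeff h = 1" "degree h = 2 ^ (n - 1)"
      using degp degg unfolding h_def lead_coeff_smult by simp_all
  qed
  have h0: "h \<noteq> 0" using lch by auto
  have irr: "irreducible h"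
  proof (rule irreducibleI)
    show "h \<noteq> 0" by fact
    show "\<not> is_unit h" using h0 degh by (simp add: is_unit_iff_degree)
    fix r t assume h: "h = r * t"
    show "is_unit r \<or> is_unit t"
    proof (rule ccontr)
      assume "\<not> (is_unit r \<or> is_unit t)"
      then have ru: "\<not> is_unit r" and tu: "\<not> is_unit t" by auto
      have "p = smult (lead_coeff p) (r * t)"
        using p0 by (simp flip: h add: h_def)
      then have "F = r * (smult (lead_coeff p) t * q)"
        using pq by (metis mult.assoc mult_smult_left mult_smult_right)
      moreover have "\<not> is_unit (smult (lead_coeff p) t * q)"
        using qu is_unit_mult_iff by blast
      (* r already has the full degree of h, so nothing is left for t. *)
      ultimately have "degree r = degree g"
        using norm_of_factor_of_irreducible_comp_quadratic[OF a g _ ru] Fg by metis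
      moreover have "degree h = degree r + degree t"
        using h h0 by (auto simp: degree_mult_eq)
      ultimately have "degree t = 0" using degh degg by simp
      then show False using tu h h0 by (auto simp: is_unit_iff_degree)
    qed
  qed
  have norm_h: "h * pcompose h s = smult (k / (lead_coeff p)\<^sup>2) F"
    using norm_p by (simp add: h_def pcompose_smult power2_eq_square)
  (* Conjugation multiplies the leading coefficient by (-1)^(2^(n-1)), which is 1 for n at
     least 2; comparing leading coefficients then determines the constant. *)
  have "lead_coeff (h * pcompose h s) = 1"
  proof -
    have "lead_coeff (pcompose h s) = lead_coeff h * (-1) ^ degree h"
      by (subst lead_coeff_comp) (simp_all add: s_def)
    also have "even (degree h)" using degh n by simp
    then have "(-1) ^ degree h = (1::'a)" by simp
    finally show ?thesis using lch by (simp add: lead_coeff_mult)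
  qed
  then have scale: "k / (lead_coeff p)\<^sup>2 * a ^ (2 ^ n - 1) = 1"
    unfolding norm_h lead_coeff_smult lcF .
  have eq: "F = smult (a ^ (2 ^ n - 1)) (h * pcompose h s)"
    unfolding norm_h smult_smult mult.commute[of "a ^ (2 ^ n - 1)"] scale by simp
  have sym: "symmetrically_reducible (pcompose F [:-(b / (2 * a)), 1:])" if char: "CHAR('a) \<noteq> 2"
  proof -
    define tr where "tr = [:-(b / (2 * a)), 1:]"
    have two: "(2::'a) \<noteq> 0"
    proof
      assume "(2::'a) = 0"
      then have "CHAR('a) dvd 2"
        by (simp flip: of_nat_eq_0_iff_char_dvd)
      then have "CHAR('a) \<le> 2"
        by (rule dvd_imp_le) simp
      moreover have "CHAR('a) \<noteq> 1" "CHAR('a) \<noteq> 0"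
        by simp (use \<open>CHAR('a) dvd 2\<close> in \<open>metis dvd_0_left zero_neq_numeral\<close>)
      ultimately show False using char by linarith
    qed
    have reflect: "pcompose s tr = pcompose tr [:0, -1:]"
      using two a by (simp add: s_def tr_def pcompose_pCons field_simps)
    have "pcompose F tr = smult (a ^ (2 ^ n - 1)) (pcompose h tr * pcompose (pcompose h tr) [:0, -1:])"
      unfolding eq by (simp add: pcompose_smult pcompose_mult reflect flip: pcompose_assoc)
    moreover have "lead_coeff (pcompose h tr) = 1"
      using lch by (subst lead_coeff_comp) (simp_all add: tr_def)
    moreover have "degree (pcompose F tr) = 2 * 2 ^ (n - 1)"
      using degF2 degg by (simp add: tr_def degree_pcompose)
    ultimately show ?thesis
      unfolding symmetrically_reducible_def tr_def[symmetric]
      by (intro conjI exI[of _ "2 ^ (n - 1)"] exI[of _ "pcompose h tr"] exI[of _ "a ^ (2 ^ n - 1)"])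
        simp_all
  qed
  show ?thesis
    using lch irr degh eq sym unfolding F_def s_def by (intro conjI exI[of _ h] impI)
qed

end
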